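(* Let $F:\mathbb D\subset\mathbb X\to\mathbb Y$ be a continuously Fréchet differentiable nonlinear operator, $\mathbb D$ open and convex, and let $\gamma>0$. Assume that there is an initial point $x_0\in\mathbb D$ such that $F'(x_0)^{-1}$ exists and $$\|F'(x_0)^{-1}[F'(y)-F'(x)]\|\le\frac{1}{(1-\gamma\|x-x_0\|-\gamma\|y-x\|)^2}-\frac{1}{(1-\gamma\|x-x_0\|)^2}$$ for all $x,y\in\mathbf B(x_0,r_0)$ with $\|x-x_0\|+\|y-x\|<r_0$, where $r_0=\left(1-\frac1{\sqrt2}\right)\frac1\gamma$. Let $\{x_k\}$ be the sequence generated by the two-step Newton method with initial point $x_0$, and let $\alpha:=\beta\gamma$. If $0<\alpha\le3-2\sqrt2$, then $\{x_k\}$ is well-defined and converges Q-superquadratically to a solution $x^*\in\overline{\mathbf B(x_0,t^* )}$ of $F(x)=0$, and this solution $x^*$ is unique in $\overline{\mathbf B(x_0,r)}$, where $t^*\le r<t^{**}$ and $$t^*=\frac{1+\alpha-\sqrt{(1+\alpha)^2-8\alpha}}{4\gamma},\qquad t^{**}=\frac{1+\alpha+\sqrt{(1+\alpha)^2-8\alpha}}{4\gamma}.$$ Moreover, if $0<\alpha<3-\sqrt[3]{2}-\sqrt[3]{4}$, then the order of convergence is at least cubic (Q-cubic) and $$\|x^*-x_{k+1}\|\le\frac{qH_*^2}{2}\cdot\|x^*-x_k\|^3,\qquad k\ge0,$$ where $$H_*=-\frac{32\gamma}{\sqrt{(1+\alpha)^2-8\alpha}\cdot\left(3-\alpha+\sqrt{(1+\alpha)^2-8\alpha}\right)^2}$$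 and $$q:=\frac{\sqrt{(1+\alpha)^2-8\alpha}\cdot(3-\alpha+\sqrt{(1+\alpha)^2-8\alpha})^2+4(1+\alpha-\sqrt{(1+\alpha)^2-8\alpha})}{\sqrt{(1+\alpha)^2-8\alpha}\cdot(3-\alpha+\sqrt{(1+\alpha)^2-8\alpha})^2-4(1+\alpha-\sqrt{(1+\alpha)^2-8\alpha})}.$$
   Context: $\mathbb X,\mathbb Y$ are Banach spaces; $\mathbf B(x,r)$ is the open ball with center $x$ and radius $r$, and $\overline{\mathbf B(x,r)}$ its closure. It is assumed that $\mathbf B(x_0,r_0)\subset\mathbb D$. Set $\beta:=\|F'(x_0)^{-1}F(x_0)\|$. Two-step Newton method: $y_k=x_k-F'(x_k)^{-1}F(x_k)$, $x_{k+1}=y_k-F'(x_k)^{-1}F(y_k)$, $k=0,1,2,\dots$. $\{x_k\}$ converges to $x^*$ Q-superquadratically if for any $c>0$ there is $N_c\ge0$ with $\|x_{k+1}-x^*\|\le c\|x_k-x^*\|^2$ for all $k\ge N_c$; it converges Q-cubically if there are constants $c\ge0$, $N_c\ge0$ with $\|x_{k+1}-x^*\|\le c\|x_k-x^*\|^3$ for all $k\ge N_c$.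
   Formalization: At α=3−2√2 superquadratic convergence is dropped (a double zero gives a linear rate) and F(x* )=0 is claimed only if x*∈D (else F→0 at x* ). Uniqueness for radius r also assumes the Lipschitz-type condition on D∩B(x0,r) with radius r, which is automatic for r≤r0. *)

theory Defs
  imports "HOL-Analysis.Analysis"
begin

definition blinfun_invertible ::
    "('a::real_normed_vector \<Rightarrow>\<^sub>L 'b::real_normed_vector) \<Rightarrow> bool" where
  "blinfun_invertible A \<longleftrightarrow> (\<exists>B. B o\<^sub>L A = id_blinfun \<and> A o\<^sub>L B = id_blinfun)"

(* Only meaningful for operators satisfying blinfun_invertible. *)
definition blinfun_inv ::
    "('a::real_normed_vector \<Rightarrow>\<^sub>L 'b::real_normed_vector) \<Rightarrow> ('b \<Rightarrow>\<^sub>L 'a)" where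
  "blinfun_inv A = (THE B. B o\<^sub>L A = id_blinfun \<and> A o\<^sub>L B = id_blinfun)"

definition newton_step ::
    "('a::real_normed_vector \<Rightarrow> 'b::real_normed_vector) \<Rightarrow> ('a \<Rightarrow> ('a \<Rightarrow>\<^sub>L 'b)) \<Rightarrow> 'a \<Rightarrow> 'a" where
  "newton_step F F' x = x - blinfun_inv (F' x) (F x)"

primrec two_step_newton ::
    "('a::real_normed_vector \<Rightarrow> 'b::real_normed_vector) \<Rightarrow> ('a \<Rightarrow> ('a \<Rightarrow>\<^sub>L 'b)) \<Rightarrow> 'a \<Rightarrow> nat \<Rightarrow> 'a" where
  "two_step_newton F F' x0 0 = x0"
| "two_step_newton F F' x0 (Suc k) =
     (let x = two_step_newton F F' x0 k; y = newton_step F F' x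
      in y - blinfun_inv (F' x) (F y))"

(* The iteration above is a total function, so the assertion that the sequence is well-defined
   has to be made separately: F and F' are only ever evaluated on D, and the operators to be
   inverted are invertible. *)
definition two_step_newton_well_defined ::
    "'a set \<Rightarrow> ('a::real_normed_vector \<Rightarrow> 'b::real_normed_vector) \<Rightarrow> ('a \<Rightarrow> ('a \<Rightarrow>\<^sub>L 'b)) \<Rightarrow> 'a \<Rightarrow> bool" where
  "two_step_newton_well_defined D F F' x0 \<longleftrightarrow>
     (\<forall>k. two_step_newton F F' x0 k \<in> D \<and>
          blinfun_invertible (F' (two_step_newton F F' x0 k)) \<and>
          newton_step F F' (two_step_newton F F' x0 k) \<in> D)"

definition Q_superquadratic :: "(nat \<Rightarrow> 'a::real_normed_vector) \<Rightarrow> 'a \<Rightarrow> bool" where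
  "Q_superquadratic x xs \<longleftrightarrow> x \<longlonglongrightarrow> xs \<and>
     (\<forall>c>0. \<exists>N. \<forall>k\<ge>N. norm (x (Suc k) - xs) \<le> c * norm (x k - xs) ^ 2)"

definition Q_cubic :: "(nat \<Rightarrow> 'a::real_normed_vector) \<Rightarrow> 'a \<Rightarrow> bool" where
  "Q_cubic x xs \<longleftrightarrow> x \<longlonglongrightarrow> xs \<and>
     (\<exists>c\<ge>0. \<exists>N. \<forall>k\<ge>N. norm (x (Suc k) - xs) \<le> c * norm (x k - xs) ^ 3)"

(* The Lipschitz-type condition for points of S with norm (x - x0) + norm (y - x) < \<rho>.
   It is stated relative to S because F' carries no information outside the domain of F. *)
definition gamma_condition ::
    "('a \<Rightarrow> ('a::real_normed_vector \<Rightarrow>\<^sub>L 'b::real_normed_vector)) \<Rightarrow> 'a \<Rightarrow> real \<Rightarrow> 'a set \<Rightarrow> real \<Rightarrow> bool" where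
  "gamma_condition F' x0 \<gamma> S \<rho> \<longleftrightarrow>
     (\<forall>x\<in>S. \<forall>y\<in>S. norm (x - x0) + norm (y - x) < \<rho> \<longrightarrow>
        norm (blinfun_inv (F' x0) o\<^sub>L (F' y - F' x))
          \<le> 1 / (1 - \<gamma> * norm (x - x0) - \<gamma> * norm (y - x)) ^ 2 - 1 / (1 - \<gamma> * norm (x - x0)) ^ 2)"

end

theory Submission
  imports Defs
begin

text \<open>
  Put \<open>P = F'(x0)\<^sup>-\<^sup>1\<close> and \<open>h(t) = \<beta> - t + \<gamma> t\<^sup>2 / (1 - \<gamma> t)\<close>, whose roots are \<open>t1 \<le> t2\<close>. The
  \<open>\<gamma>\<close>-condition bounds \<open>P (F'(y) - F'(x))\<close> by the increments of \<open>h'\<close>, so integrating along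
  segments bounds the linearization errors of \<open>P \<circ> F\<close> by those of \<open>h\<close>. Instead of comparing with the
  scalar Newton sequence of \<open>h\<close>, one follows the length \<open>T\<^sub>k\<close> of the polygon
  \<open>x\<^sub>0, y\<^sub>0, x\<^sub>1, y\<^sub>1, ..., x\<^sub>k\<close>: by convexity of \<open>h\<close>, the relations \<open>T\<^sub>k < t1\<close> and
  \<open>\<parallel>P F(x\<^sub>k)\<parallel> \<le> h(T\<^sub>k)\<close> persist, which gives convergence to a point \<open>xs\<close> with
  \<open>\<parallel>xs - x\<^sub>k\<parallel> \<le> t1 - T\<^sub>k\<close>.

  A zero \<open>z\<close> satisfies \<open>h(\<parallel>z - x0\<parallel>) \<ge> 0\<close>, hence cannot lie at a distance from \<open>x0\<close> strictly between
  \<open>t1\<close> and \<open>t2\<close>; and on the closed ball of radius \<open>t1 < t2\<close> the map \<open>P \<circ> F - id\<close> is a contraction.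

  With \<open>K = h''(t1) / (2 \<bar>h'(t1)\<bar>) = - H / 2\<close> and \<open>e\<^sub>k = \<parallel>xs - x\<^sub>k\<parallel>\<close>, a Newton step has error at most
  \<open>K e\<^sub>k\<^sup>2\<close>, and reusing the derivative for the second step gives
  \<open>e\<^sub>k\<^sub>+\<^sub>1 \<le> 2 K\<^sup>2 (1 + K e\<^sub>k) e\<^sub>k\<^sup>3\<close>. Since \<open>q = (1 + K t1) / (1 - K t1)\<close>, this is the asserted bound as soon
  as \<open>K t1 < 1\<close>, which is what \<open>\<alpha> < 3 - root 3 2 - root 3 4\<close> says.
\<close>

section \<open>Invertible bounded linear operators\<close>

text \<open>A left inverse agrees with every two-sided inverse, so the definite description in
  \<open>blinfun_inv\<close> denotes.\<close>

lemma
  assumes "blinfun_invertible A"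
  shows blinfun_inv_left: "blinfun_inv A (A v) = v"
    and blinfun_inv_right: "A (blinfun_inv A w) = w"
proof -
  obtain B where B: "B o\<^sub>L A = id_blinfun" "A o\<^sub>L B = id_blinfun"
    using assms unfolding blinfun_invertible_def by blast
  have BA: "B (A v) = v" and AB: "A (B w) = w" for v w
    using arg_cong[OF B(1), of "\<lambda>C. C v"] arg_cong[OF B(2), of "\<lambda>C. C w"] by simp_all
  have uniq: "C = B" if "C o\<^sub>L A = id_blinfun" for C
  proof (rule blinfun_eqI)
    fix w
    show "C w = B w"
      using arg_cong[OF that, of "\<lambda>C. C (B w)"] by (simp add: AB)
  qed
  have "blinfun_inv A = B"
    unfolding blinfun_inv_def by (rule the_equality) (use B uniq in blast)+
  then show "blinfun_inv A (A v) = v" "A (blinfun_inv A w) = w"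
    by (simp_all add: BA AB)
qed

lemma blinfun_invertibleI:
  fixes A :: "'a::real_normed_vector \<Rightarrow>\<^sub>L 'b::real_normed_vector"
  assumes "bounded_linear g" "\<And>v. g (A v) = v" "\<And>w. A (g w) = w"
  shows "blinfun_invertible A"
  unfolding blinfun_invertible_def
  by (intro exI[of _ "Blinfun g"] conjI blinfun_eqI)
     (simp_all add: bounded_linear_Blinfun_apply assms)

text \<open>Solving \<open>v - E v = w\<close> is a fixed-point problem for the contraction
  \<open>v \<mapsto> w + E v\<close>; the lower estimate \<open>bound\<close> gives uniqueness of
  the solution and boundedness of the inverse.\<close>

lemma blinfun_invertible_near_id:
  fixes E :: "'a::banach \<Rightarrow>\<^sub>L 'a"
  assumes "norm E < 1"
  shows "blinfun_invertible (id_blinfun - E)"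
proof -
  have bound: "(1 - norm E) * norm v \<le> norm (v - E v)" for v
  proof -
    have "norm v \<le> norm (v - E v) + norm (E v)"
      using norm_triangle_ineq[of "v - E v" "E v"] by simp
    then show ?thesis
      using norm_blinfun[of E v] by (simp add: algebra_simps)
  qed
  have inj: "v = w" if "v - E v = w - E w" for v w
  proof -
    have "(v - w) - E (v - w) = 0"
      using that by (simp add: blinfun.diff_right algebra_simps)
    then have "(1 - norm E) * norm (v - w) \<le> 0"
      using bound[of "v - w"] by simp
    then show ?thesis
      using assms by (simp add: mult_le_0_iff)
  qed
  have "\<exists>v. v - E v = w" for w
  proof -
    have "dist (w + E u) (w + E v) \<le> norm E * dist u v" for u v
      using norm_blinfun[of E "u - v"] by (simp add: dist_norm blinfun.diff_right)
    then obtain v where "w + E v = v"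
      using banach_fix_type[of "norm E" "\<lambda>v. w + E v"] assms by auto
    then show ?thesis
      by (metis add_diff_cancel_right')
  qed
  then obtain g where g: "g w - E (g w) = w" for w
    by metis
  have "bounded_linear g"
  proof (rule bounded_linear_intro)
    show "g (v + w) = g v + g w" for v w
      by (rule inj) (simp add: g blinfun.add_right add_diff_add)
    show "g (r *\<^sub>R v) = r *\<^sub>R g v" for r v
      by (rule inj) (simp add: g blinfun.scaleR_right flip: scaleR_diff_right)
    show "norm (g w) \<le> norm w * (1 / (1 - norm E))" for w
      using bound[of "g w"] assms unfolding g by (simp add: field_simps)
  qed
  then show ?thesis
    by (rule blinfun_invertibleI) (simp_all add: blinfun.diff_left g inj)
qed

text \<open>The factorization \<open>B = A (id - E)\<close> with \<open>E = - A^-1 (B - A)\<close>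
  reduces this to the previous lemma. The two inverses are compared at a single vector
  \<open>w\<close>, because later only vectors such as \<open>P (F x)\<close> are
  controlled.\<close>

lemma blinfun_invertible_perturbation:
  fixes A B :: "'a::banach \<Rightarrow>\<^sub>L 'b::real_normed_vector"
  assumes A: "blinfun_invertible A"
    and c: "norm (blinfun_inv A o\<^sub>L (B - A)) \<le> c" "c < 1"
  shows "blinfun_invertible B"
    and "norm (blinfun_inv B w) \<le> norm (blinfun_inv A w) / (1 - c)"
proof -
  define E where "E = - (blinfun_inv A o\<^sub>L (B - A))"
  define G where "G = id_blinfun - E"
  have G: "G v = blinfun_inv A (B v)" for v
    unfolding G_def E_def
    by (simp add: blinfun.diff_left blinfun.add_left blinfun.minus_left blinfun.diff_right
        blinfun_inv_left[OF A] del: diff_minus_eq_add)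
  have B: "B v = A (G v)" for v
    by (simp add: G blinfun_inv_right[OF A])
  have normE: "norm E \<le> c"
    using c by (simp add: E_def)
  have Ginv: "blinfun_invertible G"
    unfolding G_def using normE c(2) by (intro blinfun_invertible_near_id) simp
  have "bounded_linear (\<lambda>w. blinfun_inv G (blinfun_inv A w))"
    by (intro bounded_linear_intros)
  then show inv: "blinfun_invertible B"
    by (rule blinfun_invertibleI)
       (simp_all add: B blinfun_inv_left blinfun_inv_right A Ginv)
  define v where "v = blinfun_inv B w"
  have eq: "blinfun_inv A w = v - E v"
    using G[of v] by (simp add: v_def blinfun_inv_right[OF inv] G_def blinfun.diff_left)
  have "norm (E v) \<le> c * norm v"
    using norm_blinfun[of E v] normE by (meson mult_right_mono norm_ge_zero order_trans)
  moreover have "norm v \<le> norm (v - E v) + norm (E v)"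
    using norm_triangle_ineq[of "v - E v" "E v"] by simp
  ultimately have "norm v * (1 - c) \<le> norm (blinfun_inv A w)"
    unfolding eq by (simp add: algebra_simps)
  then show "norm (blinfun_inv B w) \<le> norm (blinfun_inv A w) / (1 - c)"
    using c(2) by (simp add: v_def[symmetric] pos_le_divide_eq)
qed

text \<open>The mean value inequality for
  \<open>P (F (y + \<tau> (z - y)) - \<tau> M (z - y))\<close> replaces integration,
  \<open>\<phi>\<close> being an antiderivative of the bound. Asking for the bound only at interior
  \<open>\<tau>\<close> lets \<open>z\<close> sit on the boundary of the region where the gamma
  condition speaks.\<close>

lemma linearization_bound:
  fixes F :: "'a::real_normed_vector \<Rightarrow> 'b::real_normed_vector"
    and P :: "'b \<Rightarrow>\<^sub>L 'c::real_normed_vector"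
  assumes deriv: "\<And>p. p \<in> closed_segment y z \<Longrightarrow> (F has_derivative blinfun_apply (F' p)) (at p)"
    and cont: "continuous_on {0..1} \<phi>"
    and \<phi>': "\<And>\<tau>. 0 < \<tau> \<Longrightarrow> \<tau> < 1 \<Longrightarrow> (\<phi> has_real_derivative \<phi>' \<tau>) (at \<tau>)"
    and bound: "\<And>\<tau>. 0 < \<tau> \<Longrightarrow> \<tau> < 1 \<Longrightarrow>
      norm (P o\<^sub>L (F' (y + \<tau> *\<^sub>R (z - y)) - M)) * norm (z - y) \<le> \<phi>' \<tau>"
  shows "norm (P (F z - F y - M (z - y))) \<le> \<phi> 1 - \<phi> 0"
proof -
  let ?p = "\<lambda>\<tau>. y + \<tau> *\<^sub>R (z - y)"
  define f where "f = (\<lambda>\<tau>. P (F (?p \<tau>) - \<tau> *\<^sub>R M (z - y)))"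
  have f': "(f has_vector_derivative P (F' (?p \<tau>) (z - y) - M (z - y))) (at \<tau>)"
    if "0 \<le> \<tau>" "\<tau> \<le> 1" for \<tau>
  proof -
    have "?p \<tau> \<in> closed_segment y z"
      using that unfolding closed_segment_def by (auto simp: algebra_simps intro!: exI[of _ \<tau>])
    from deriv[OF this] have "(F has_derivative blinfun_apply (F' (?p \<tau>))) (at (?p \<tau>))" .
    moreover have "(?p has_derivative (\<lambda>h. h *\<^sub>R (z - y))) (at \<tau>)"
      by (auto intro!: derivative_eq_intros)
    ultimately have "((\<lambda>\<tau>. F (?p \<tau>)) has_derivative (\<lambda>h. F' (?p \<tau>) (h *\<^sub>R (z - y)))) (at \<tau>)"
      by (rule has_derivative_compose[rotated])
    then have "(f has_derivative (\<lambda>h. P (F' (?p \<tau>) (h *\<^sub>R (z - y)) - h *\<^sub>R M (z - y)))) (at \<tau>)"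
      unfolding f_def
      by (intro bounded_linear.has_derivative[OF blinfun.bounded_linear_right] has_derivative_diff)
         (auto intro!: derivative_eq_intros)
    then show ?thesis
      unfolding has_vector_derivative_def
      by (simp add: blinfun.scaleR_right blinfun.diff_right scaleR_diff_right)
  qed
  have "norm (f 1 - f 0) \<le> \<phi> 1 - \<phi> 0"
  proof (rule differentiable_bound_general[where \<phi>' = \<phi>'])
    show "continuous_on {0..1} f"
      by (intro continuous_at_imp_continuous_on ballI has_vector_derivative_continuous[OF f']) auto
    show "(\<phi> has_vector_derivative \<phi>' \<tau>) (at \<tau>)" if "0 < \<tau>" "\<tau> < 1" for \<tau>
      using \<phi>'[OF that] by (simp add: has_real_derivative_iff_has_vector_derivative)
    show "(f has_vector_derivative P (F' (?p \<tau>) (z - y) - M (z - y))) (at \<tau>)"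
      if "0 < \<tau>" "\<tau> < 1" for \<tau>
      using f' that by simp
    show "norm (P (F' (?p \<tau>) (z - y) - M (z - y))) \<le> \<phi>' \<tau>" if "0 < \<tau>" "\<tau> < 1" for \<tau>
      using order_trans[OF norm_blinfun bound[OF that]] by (simp add: blinfun.diff_left)
  qed (use cont in auto)
  moreover have "f 1 - f 0 = P (F z - F y - M (z - y))"
    by (simp add: f_def blinfun.diff_right)
  ultimately show ?thesis
    by simp
qed

section \<open>The majorant function\<close>

text \<open>Partial fractions of
  \<open>\<beta> - t + \<gamma> t^2 / (1 - \<gamma> t)\<close>.\<close>

definition majorant :: "real \<Rightarrow> real \<Rightarrow> real \<Rightarrow> real" where
  "majorant \<gamma> \<beta> t = \<beta> - 2 * t - 1 / \<gamma> + 1 / (\<gamma> * (1 - \<gamma> * t))"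

text \<open>In differences the \<open>- 2\<close> cancels and leaves exactly the right-hand side of
  \<open>gamma_condition\<close>.\<close>

definition majorant_deriv :: "real \<Rightarrow> real \<Rightarrow> real" where
  "majorant_deriv \<gamma> t = 1 / (1 - \<gamma> * t) ^ 2 - 2"

lemma majorant_0: "majorant \<gamma> \<beta> 0 = \<beta>" and majorant_deriv_0: "majorant_deriv \<gamma> 0 = - 1"
  by (simp_all add: majorant_def majorant_deriv_def)

lemma majorant_has_deriv:
  assumes "\<gamma> > 0" "\<gamma> * t < 1"
  shows "(majorant \<gamma> \<beta> has_real_derivative majorant_deriv \<gamma> t) (at t)"
  unfolding majorant_def[abs_def] majorant_deriv_def using assms
  by (auto intro!: derivative_eq_intros) (simp add: field_simps power2_eq_square)

text \<open>Taylor expansion with exact second-order remainder; the sign of the remainder is the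
  strict convexity of the majorant.\<close>

lemma majorant_add:
  assumes "\<gamma> > 0" "\<gamma> * t < 1" "\<gamma> * (t + d) < 1"
  shows "majorant \<gamma> \<beta> (t + d) = majorant \<gamma> \<beta> t + majorant_deriv \<gamma> t * d
    + \<gamma> * d ^ 2 / ((1 - \<gamma> * (t + d)) * (1 - \<gamma> * t) ^ 2)"
proof -
  define w v where "w = 1 - \<gamma> * t" and "v = 1 - \<gamma> * (t + d)"
  have "w > 0" "v > 0" and d: "d = (w - v) / \<gamma>"
    using assms by (auto simp: w_def v_def field_simps)
  have "1 / (\<gamma> * v) = 1 / (\<gamma> * w) + d / w ^ 2 + \<gamma> * d ^ 2 / (v * w ^ 2)"
    using \<open>w > 0\<close> \<open>v > 0\<close> assms(1) unfolding d by (simp add: divide_simps) algebra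
  then show ?thesis
    unfolding majorant_def majorant_deriv_def w_def[symmetric] v_def[symmetric]
    by (simp add: algebra_simps)
qed

lemma majorant_tangent:
  assumes "\<gamma> > 0" "\<gamma> * t < 1" "\<gamma> * u < 1" "t \<noteq> u"
  shows "majorant \<gamma> \<beta> t + majorant_deriv \<gamma> t * (u - t) < majorant \<gamma> \<beta> u"
proof -
  have "0 < \<gamma> * (u - t) ^ 2 / ((1 - \<gamma> * u) * (1 - \<gamma> * t) ^ 2)"
    using assms by (intro divide_pos_pos mult_pos_pos zero_less_power2[THEN iffD2]) auto
  then show ?thesis
    using majorant_add[of \<gamma> t "u - t" \<beta>] assms by simp
qed

lemma majorant_deriv_mono:
  assumes "\<gamma> > 0" "t \<le> u" "\<gamma> * u < 1"
  shows "majorant_deriv \<gamma> t \<le> majorant_deriv \<gamma> u"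
proof -
  have "\<gamma> * t \<le> \<gamma> * u"
    using assms by simp
  moreover from this have "\<gamma> * t < 1"
    using assms by linarith
  ultimately show ?thesis
    unfolding majorant_deriv_def using assms
    by (intro diff_right_mono divide_left_mono power_mono mult_pos_pos zero_less_power) auto
qed

text \<open>The derivative is convex and increasing: convexity moves the base point from
  \<open>a\<close> to \<open>t\<close>, monotonicity enlarges the increment from \<open>b\<close> to
  \<open>d\<close>. This is what allows true distances to be replaced by upper bounds.\<close>

lemma majorant_deriv_diff_mono:
  assumes "\<gamma> > 0" "a \<le> t" "0 \<le> b" "b \<le> d" "\<gamma> * (t + d) < 1"
  shows "majorant_deriv \<gamma> (a + b) - majorant_deriv \<gamma> a
    \<le> majorant_deriv \<gamma> (t + d) - majorant_deriv \<gamma> t"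
proof -
  have "\<gamma> * (t + b) \<le> \<gamma> * (t + d)"
    using assms by simp
  then have tb: "\<gamma> * (t + b) < 1"
    using assms by linarith
  have *: "((\<lambda>t. majorant_deriv \<gamma> (t + b) - majorant_deriv \<gamma> t) has_real_derivative
      2 * \<gamma> / (1 - \<gamma> * (u + b)) ^ 3 - 2 * \<gamma> / (1 - \<gamma> * u) ^ 3) (at u)"
    if "\<gamma> * u < 1" "\<gamma> * (u + b) < 1" for u
    unfolding majorant_deriv_def using that
    by (auto intro!: derivative_eq_intros) (simp add: divide_simps eval_nat_numeral)
  have "majorant_deriv \<gamma> (a + b) - majorant_deriv \<gamma> a
    \<le> majorant_deriv \<gamma> (t + b) - majorant_deriv \<gamma> t"
  proof (rule DERIV_nonneg_imp_nondecreasing[OF assms(2)])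
    fix u assume u: "a \<le> u" "u \<le> t"
    have "\<gamma> * u \<le> \<gamma> * (u + b)" "\<gamma> * (u + b) \<le> \<gamma> * (t + b)"
      using u assms by auto
    then have lt: "\<gamma> * u < 1" "\<gamma> * (u + b) < 1"
      using tb by auto
    have "0 \<le> 2 * \<gamma> / (1 - \<gamma> * (u + b)) ^ 3 - 2 * \<gamma> / (1 - \<gamma> * u) ^ 3"
      unfolding diff_ge_0_iff_ge using lt \<open>\<gamma> * u \<le> \<gamma> * (u + b)\<close> assms(1)
      by (intro divide_left_mono power_mono mult_pos_pos zero_less_power) linarith+
    then show "\<exists>D. ((\<lambda>t. majorant_deriv \<gamma> (t + b) - majorant_deriv \<gamma> t) has_real_derivative D) (at u)
        \<and> 0 \<le> D"
      using *[OF lt] by blast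
  qed
  moreover have "majorant_deriv \<gamma> (t + b) \<le> majorant_deriv \<gamma> (t + d)"
    by (rule majorant_deriv_mono) (use assms in auto)
  ultimately show ?thesis
    by simp
qed

lemma majorant_deriv_lipschitz:
  assumes "\<gamma> > 0" "0 \<le> b" "a + b \<le> t" "\<gamma> * t < 1"
  shows "majorant_deriv \<gamma> (a + b) - majorant_deriv \<gamma> a \<le> 2 * \<gamma> / (1 - \<gamma> * t) ^ 3 * b"
proof (cases "b = 0")
  case False
  have *: "(majorant_deriv \<gamma> has_real_derivative 2 * \<gamma> / (1 - \<gamma> * u) ^ 3) (at u)"
    if "\<gamma> * u < 1" for u
    unfolding majorant_deriv_def[abs_def] using that
    by (auto intro!: derivative_eq_intros) (simp add: divide_simps eval_nat_numeral)
  have le: "\<gamma> * u \<le> \<gamma> * t" if "u \<le> a + b" for u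
    using that assms by simp
  then have lt: "\<gamma> * u < 1" if "u \<le> a + b" for u
    using that assms(4) by fastforce
  obtain u where u: "a < u" "u < a + b"
    "majorant_deriv \<gamma> (a + b) - majorant_deriv \<gamma> a = (a + b - a) * (2 * \<gamma> / (1 - \<gamma> * u) ^ 3)"
    using MVT2[of a "a + b" "majorant_deriv \<gamma>" "\<lambda>u. 2 * \<gamma> / (1 - \<gamma> * u) ^ 3"] * lt False assms
    by auto
  have mono: "2 * \<gamma> / (1 - \<gamma> * u) ^ 3 \<le> 2 * \<gamma> / (1 - \<gamma> * t) ^ 3"
    using le[of u] lt[of u] u assms by (intro divide_left_mono power_mono mult_pos_pos zero_less_power) auto
  then show ?thesis
    using u(3) mult_left_mono[OF mono assms(2)] by (simp add: mult.commute)
qed simp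

lemma majorant_step:
  assumes "\<gamma> > 0" "t \<le> s" "s < t1" "\<gamma> * t1 < 1" "majorant \<gamma> \<beta> t1 = 0" "majorant_deriv \<gamma> t < 0"
    and step: "- majorant_deriv \<gamma> t * d \<le> majorant \<gamma> \<beta> s"
  shows "s + d < t1"
proof -
  have s1: "\<gamma> * s < 1"
    using assms(1,3,4) by (meson mult_strict_left_mono order.strict_trans)
  have "majorant \<gamma> \<beta> s + majorant_deriv \<gamma> s * (t1 - s) < 0"
    using majorant_tangent[of \<gamma> s t1 \<beta>] assms s1 by simp
  moreover have "majorant_deriv \<gamma> t * (t1 - s) \<le> majorant_deriv \<gamma> s * (t1 - s)"
    using majorant_deriv_mono[OF assms(1,2) s1] assms(3) by (simp add: mult_right_mono)
  ultimately have "0 < majorant_deriv \<gamma> t * (s + d - t1)"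
    using step by (simp add: algebra_simps)
  then show ?thesis
    using assms(6) by (simp add: zero_less_mult_iff)
qed

section \<open>Operators satisfying the gamma condition\<close>

locale gamma_newton =
  fixes F :: "'a::banach \<Rightarrow> 'b::banach"
    and F' :: "'a \<Rightarrow> ('a \<Rightarrow>\<^sub>L 'b)"
    and D :: "'a set" and x0 :: 'a and \<gamma> r0 :: real
  assumes r0: "r0 = (1 - 1 / sqrt 2) * (1 / \<gamma>)"
    and convex_D: "convex D"
    and deriv: "\<And>z. z \<in> D \<Longrightarrow> (F has_derivative blinfun_apply (F' z)) (at z)"
    and \<gamma>_pos: "\<gamma> > 0"
    and x0: "x0 \<in> D" and ball: "ball x0 r0 \<subseteq> D"
    and inv: "blinfun_invertible (F' x0)"
    and gamma: "gamma_condition F' x0 \<gamma> (ball x0 r0) r0"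
begin

abbreviation P :: "'b \<Rightarrow>\<^sub>L 'a" where "P \<equiv> blinfun_inv (F' x0)"
abbreviation h :: "real \<Rightarrow> real" where "h \<equiv> majorant \<gamma> (norm (P (F x0)))"
abbreviation h' :: "real \<Rightarrow> real" where "h' \<equiv> majorant_deriv \<gamma>"

lemma gamma_r0: "\<gamma> * r0 = 1 - 1 / sqrt 2" "\<gamma> * r0 < 1"
  using \<gamma>_pos by (simp_all add: r0)

lemma less_r0: "t \<le> r0 \<Longrightarrow> \<gamma> * t < 1"
  using gamma_r0(2) \<gamma>_pos by (smt (verit) mult_left_mono)

text \<open>The radius \<open>r0\<close> is where \<open>(1 - \<gamma> t)^2 = 1 / 2\<close>, that
  is, the minimizer of \<open>h\<close>.\<close>

lemma h'_r0: "h' r0 = 0"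
  by (simp add: majorant_deriv_def gamma_r0(1) power_divide)

lemma h'_neg: "t < r0 \<Longrightarrow> h' t < 0"
proof -
  assume "t < r0"
  then have "\<gamma> * t < \<gamma> * r0"
    using \<gamma>_pos by simp
  then have "(1 - \<gamma> * r0)\<^sup>2 < (1 - \<gamma> * t)\<^sup>2"
    using gamma_r0(2) by (intro power_strict_mono) auto
  then have "1 / 2 < (1 - \<gamma> * t)\<^sup>2"
    by (simp add: gamma_r0(1) power_divide)
  then show "h' t < 0"
    unfolding majorant_deriv_def using less_r0[of t] \<open>t < r0\<close> by (simp add: field_simps)
qed

text \<open>Brings the hypothesis into the form shared with the uniqueness claim, where the radius
  is another one and the ball may leave \<open>D\<close>.\<close>

lemma gamma_D: "gamma_condition F' x0 \<gamma> (D \<inter> ball x0 r0) r0"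
  using gamma ball by (simp add: inf_absorb2)

lemma derivative_diff_bound:
  assumes gam: "gamma_condition F' x0 \<gamma> (D \<inter> ball x0 \<rho>) \<rho>" and \<rho>: "\<gamma> * \<rho> < 1"
    and "x \<in> D" "p \<in> D" "norm (x - x0) \<le> t" "norm (p - x) \<le> d" "t + d < \<rho>"
  shows "norm (P o\<^sub>L (F' p - F' x)) \<le> h' (t + d) - h' t"
proof -
  have "norm (p - x0) \<le> norm (x - x0) + norm (p - x)"
    using norm_triangle_ineq[of "x - x0" "p - x"] by simp
  then have "x \<in> D \<inter> ball x0 \<rho>" "p \<in> D \<inter> ball x0 \<rho>" "norm (x - x0) + norm (p - x) < \<rho>"
    using assms norm_ge_zero[of "p - x"]
    by (auto simp: dist_norm norm_minus_commute simp del: norm_ge_zero)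
  then have "norm (P o\<^sub>L (F' p - F' x)) \<le> h' (norm (x - x0) + norm (p - x)) - h' (norm (x - x0))"
    using gam by (simp add: gamma_condition_def majorant_deriv_def distrib_left diff_diff_eq)
  also have "\<dots> \<le> h' (t + d) - h' t"
  proof (rule majorant_deriv_diff_mono)
    have "\<gamma> * (t + d) < \<gamma> * \<rho>"
      using assms \<gamma>_pos by (intro mult_strict_left_mono)
    then show "\<gamma> * (t + d) < 1"
      using \<rho> by simp
  qed (use assms \<gamma>_pos in auto)
  finally show ?thesis .
qed

text \<open>At \<open>y + \<tau> (z - y)\<close> the distance to \<open>x\<close> is at most
  \<open>d + \<tau> e\<close>, so \<open>derivative_diff_bound\<close> integrates to increments of
  \<open>h\<close>. The derivative stays frozen at \<open>x\<close> while the segment starts at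
  \<open>y\<close>, which covers both half-steps of the method.\<close>

lemma majorant_linearization:
  assumes gam: "gamma_condition F' x0 \<gamma> (D \<inter> ball x0 \<rho>) \<rho>" and \<rho>: "\<gamma> * \<rho> < 1"
    and D: "x \<in> D" "y \<in> D" "z \<in> D"
    and x: "norm (x - x0) \<le> t" and y: "norm (y - x) \<le> d" and z: "norm (z - y) \<le> e"
    and td: "t + d < \<rho>" and tde: "t + d + e \<le> \<rho>"
  shows "norm (P (F z - F y - F' x (z - y))) \<le> h (t + d + e) - h (t + d) - h' t * e"
proof -
  let ?\<phi> = "\<lambda>\<tau>. h (t + d + \<tau> * e) - \<tau> * (h' t * e)"
  have e: "0 \<le> e"
    using z norm_ge_zero order_trans by blast
  have h: "((\<lambda>\<tau>. h (t + d + \<tau> * e)) has_real_derivative h' (t + d + \<tau> * e) * e) (at \<tau>)"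
    if "0 \<le> \<tau>" "\<tau> \<le> 1" for \<tau>
  proof (rule DERIV_chain2[where f = h and g = "\<lambda>\<tau>. t + d + \<tau> * e"])
    have "\<tau> * e \<le> e"
      using that e by (simp add: mult_left_le_one_le)
    then have "\<gamma> * (t + d + \<tau> * e) \<le> \<gamma> * \<rho>"
      using \<gamma>_pos tde by (intro mult_left_mono) auto
    then show "(h has_real_derivative h' (t + d + \<tau> * e)) (at (t + d + \<tau> * e))"
      using \<rho> by (intro majorant_has_deriv \<gamma>_pos) linarith
  qed (auto intro!: derivative_eq_intros)
  have \<phi>: "(?\<phi> has_real_derivative (h' (t + d + \<tau> * e) - h' t) * e) (at \<tau>)"
    if "0 \<le> \<tau>" "\<tau> \<le> 1" for \<tau>
    using h[OF that] by (auto intro!: derivative_eq_intros simp: algebra_simps)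
  have "norm (P (F z - F y - F' x (z - y))) \<le> ?\<phi> 1 - ?\<phi> 0"
  proof (rule linearization_bound[where \<phi> = ?\<phi>])
    show "(F has_derivative blinfun_apply (F' p)) (at p)" if "p \<in> closed_segment y z" for p
      using that convex_D D deriv by (meson closed_segment_subset subsetD)
    show "continuous_on {0..1} ?\<phi>"
      by (intro continuous_at_imp_continuous_on ballI DERIV_isCont[OF \<phi>]) auto
    fix \<tau> :: real assume \<tau>: "0 < \<tau>" "\<tau> < 1"
    show "(?\<phi> has_real_derivative (h' (t + d + \<tau> * e) - h' t) * e) (at \<tau>)"
      using \<phi> \<tau> by simp
    define p where "p = y + \<tau> *\<^sub>R (z - y)"
    have "p \<in> D"
      unfolding p_def using convexD_alt[OF convex_D D(2,3), of \<tau>] \<tau> by (simp add: algebra_simps)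
    have "norm (p - x) \<le> norm (y - x) + norm (\<tau> *\<^sub>R (z - y))"
      using norm_triangle_ineq[of "y - x" "\<tau> *\<^sub>R (z - y)"] by (simp add: p_def algebra_simps)
    also have "\<dots> \<le> d + \<tau> * e"
      using y z \<tau> by (simp add: add_mono)
    finally have p: "norm (p - x) \<le> d + \<tau> * e" .
    \<comment> \<open>The strict inequality \<open>td\<close> carries the positive weight
      \<open>1 - \<tau>\<close>, so strictness survives although \<open>tde\<close> permits
      equality.\<close>
    have "(1 - \<tau>) * (t + d) + \<tau> * (t + d + e) < (1 - \<tau>) * \<rho> + \<tau> * \<rho>"
      using td tde \<tau> by (intro add_less_le_mono mult_strict_left_mono mult_left_mono) auto
    then have lt: "t + (d + \<tau> * e) < \<rho>"
      by (simp add: algebra_simps)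
    have "norm (P o\<^sub>L (F' p - F' x)) \<le> h' (t + d + \<tau> * e) - h' t"
      using derivative_diff_bound[OF gam \<rho> D(1) \<open>p \<in> D\<close> x p lt] by (simp add: add.assoc)
    with order_trans[OF norm_ge_zero this]
    show "norm (P o\<^sub>L (F' (y + \<tau> *\<^sub>R (z - y)) - F' x)) * norm (z - y)
      \<le> (h' (t + d + \<tau> * e) - h' t) * e"
      unfolding p_def[symmetric] using z
      by (intro mult_mono) auto
  qed
  then show ?thesis
    by simp
qed

text \<open>Comparison with \<open>F' x0\<close>: the relative perturbation is at most
  \<open>h' t - h' 0 = 1 + h' t\<close>, hence the factor \<open>- h' t\<close> in the
  denominator.\<close>

lemma derivative_invertible:
  assumes "x \<in> D" "norm (x - x0) \<le> t" "t < r0"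
  shows "blinfun_invertible (F' x)"
    and "norm (blinfun_inv (F' x) w) \<le> norm (P w) / - h' t"
proof -
  have "norm (P o\<^sub>L (F' x - F' x0)) \<le> h' (0 + t) - h' 0"
    by (rule derivative_diff_bound[OF gamma_D gamma_r0(2) x0 assms(1)]) (use assms in auto)
  then have *: "norm (P o\<^sub>L (F' x - F' x0)) \<le> 1 + h' t" "1 + h' t < 1"
    using h'_neg[OF assms(3)] by (auto simp: majorant_deriv_0)
  show "blinfun_invertible (F' x)"
    by (rule blinfun_invertible_perturbation(1)[OF inv *])
  show "norm (blinfun_inv (F' x) w) \<le> norm (P w) / - h' t"
    using blinfun_invertible_perturbation(2)[OF inv *, of w] by simp
qed

text \<open>The derivative of \<open>P \<circ> F\<close> differs from the identity by at most
  \<open>1 + h' \<rho>\<close>. For \<open>\<rho> < r0\<close> this makes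
  \<open>P \<circ> F - id\<close> a contraction; for \<open>\<rho> = r0\<close> the factor is still
  \<open>1\<close>, which suffices for continuity arguments.\<close>

lemma near_identity:
  assumes y: "y \<in> ball x0 r0" "norm (y - x0) \<le> \<rho>" and z: "z \<in> ball x0 r0" "norm (z - x0) \<le> \<rho>"
    and "\<rho> \<le> r0"
  shows "norm (P (F z - F y) - (z - y)) \<le> (1 + h' \<rho>) * norm (z - y)"
proof -
  let ?\<phi> = "\<lambda>\<tau>. \<tau> * ((1 + h' \<rho>) * norm (z - y))"
  have seg: "closed_segment y z \<subseteq> ball x0 r0" "closed_segment y z \<subseteq> cball x0 \<rho>"
    using y z by (intro closed_segment_subset convex_ball convex_cball;
      simp add: dist_norm norm_minus_commute)+
  have "norm (P (F z - F y - F' x0 (z - y))) \<le> ?\<phi> 1 - ?\<phi> 0"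
  proof (rule linearization_bound[where \<phi> = ?\<phi>])
    show "(F has_derivative blinfun_apply (F' p)) (at p)" if "p \<in> closed_segment y z" for p
      using that seg(1) ball deriv by blast
    fix \<tau> :: real assume \<tau>: "0 < \<tau>" "\<tau> < 1"
    let ?p = "y + \<tau> *\<^sub>R (z - y)"
    have "?p \<in> closed_segment y z"
      using \<tau> unfolding closed_segment_def by (auto simp: algebra_simps intro!: exI[of _ \<tau>])
    then have p: "?p \<in> ball x0 r0" "norm (?p - x0) \<le> \<rho>"
      using seg by (auto simp: dist_norm norm_minus_commute)
    have "norm (P o\<^sub>L (F' ?p - F' x0)) \<le> h' (0 + norm (?p - x0)) - h' 0"
      by (rule derivative_diff_bound[OF gamma_D gamma_r0(2) x0])
         (use p ball in \<open>auto simp: dist_norm norm_minus_commute\<close>)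
    also have "\<dots> \<le> 1 + h' \<rho>"
      using majorant_deriv_mono[OF \<gamma>_pos p(2) less_r0[OF assms(5)]] by (simp add: majorant_deriv_0)
    finally show "norm (P o\<^sub>L (F' ?p - F' x0)) * norm (z - y) \<le> (1 + h' \<rho>) * norm (z - y)"
      by (simp add: mult_right_mono)
  qed (auto intro!: continuous_intros derivative_eq_intros)
  then show ?thesis
    by (simp add: blinfun.diff_right blinfun_inv_left[OF inv])
qed

lemma residual_lipschitz:
  assumes "y \<in> ball x0 r0" "z \<in> ball x0 r0"
  shows "norm (P (F z) - P (F y)) \<le> 2 * norm (z - y)"
proof -
  have "norm (P (F z - F y) - (z - y)) \<le> norm (z - y)"
    using near_identity[OF assms(1) _ assms(2), of r0] assms
    by (simp add: h'_r0 dist_norm norm_minus_commute)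
  then show ?thesis
    using norm_triangle_ineq[of "P (F z - F y) - (z - y)" "z - y"] by (simp add: blinfun.diff_right)
qed

end

section \<open>Convergence of the two-step Newton method\<close>

text \<open>Equality \<open>t1 = r0\<close> is the double root. The limit may then lie on the sphere
  of radius \<open>r0\<close>, possibly outside \<open>D\<close>, so the results on it either assume
  membership in \<open>D\<close> or concern limits from within the ball.\<close>

locale gamma_newton_root = gamma_newton +
  fixes t1 :: real
  assumes t1_pos: "0 < t1" and t1_le: "t1 \<le> r0" and h_t1: "h t1 = 0"
begin

abbreviation X :: "nat \<Rightarrow> 'a" where "X \<equiv> two_step_newton F F' x0"
abbreviation Y :: "nat \<Rightarrow> 'a" where "Y k \<equiv> newton_step F F' (X k)"

definition path_length :: "nat \<Rightarrow> real" where
  "path_length k = (\<Sum>j<k. norm (Y j - X j) + norm (X (Suc j) - Y j))"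

lemma path_length_Suc:
  "path_length (Suc k) = path_length k + norm (Y k - X k) + norm (X (Suc k) - Y k)"
  by (simp add: path_length_def)

lemma X_Suc: "X (Suc k) = Y k - blinfun_inv (F' (X k)) (F (Y k))"
  by (simp add: Let_def)

lemma in_D: "norm (p - x0) \<le> t \<Longrightarrow> t < t1 \<Longrightarrow> p \<in> D"
  using ball t1_le by (auto simp: dist_norm norm_minus_commute)

lemma less_t1: "t \<le> t1 \<Longrightarrow> \<gamma> * t < 1"
  using less_r0 t1_le by simp

text \<open>By the Newton equations \<open>F y\<close> and \<open>F x'\<close> are pure
  linearization errors. The bound \<open>h (t + d) - h t - h' t * d\<close> is at most
  \<open>h (t + d)\<close> because \<open>- h' t * d \<le> h t\<close>, and the second half-step
  repeats this from \<open>t + d\<close>.\<close>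

lemma two_step:
  fixes x y x' :: 'a
  defines "y \<equiv> newton_step F F' x"
  defines "x' \<equiv> y - blinfun_inv (F' x) (F y)"
  assumes x: "x \<in> D" "norm (x - x0) \<le> t" and t: "t < t1" and res: "norm (P (F x)) \<le> h t"
  shows "t + norm (y - x) < t1" and "t + norm (y - x) + norm (x' - y) < t1"
    and "norm (P (F x')) \<le> h (t + norm (y - x) + norm (x' - y))"
proof -
  let ?d = "norm (y - x)" and ?e = "norm (x' - y)"
  have tr: "t < r0"
    using t t1_le by simp
  have neg: "h' t < 0"
    by (rule h'_neg[OF tr])
  note inv_x = derivative_invertible[OF x tr]
  have Fx: "F' x (y - x) = - F x" and Fy: "F' x (x' - y) = - F y"
    by (simp_all add: y_def x'_def newton_step_def blinfun.minus_right blinfun_inv_right[OF inv_x(1)])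
  have "?d \<le> norm (P (F x)) / - h' t" "?e \<le> norm (P (F y)) / - h' t"
    using inv_x(2)[of "F x"] inv_x(2)[of "F y"] by (simp_all add: y_def x'_def newton_step_def)
  then have d: "- h' t * ?d \<le> norm (P (F x))" and e: "- h' t * ?e \<le> norm (P (F y))"
    using neg by (simp_all add: field_simps)
  have step_d: "- h' t * ?d \<le> h t"
    using d res by linarith
  show td: "t + ?d < t1"
    by (rule majorant_step[OF \<gamma>_pos _ t less_t1 h_t1 neg step_d]) auto
  have nd: "norm (y - x0) \<le> t + ?d"
    using norm_triangle_ineq[of "x - x0" "y - x"] x by simp
  have y_D: "y \<in> D"
    by (rule in_D[OF nd td])
  \<comment> \<open>The first half-step starts at its own linearization point, hence the middle
    argument \<open>0\<close>.\<close>
  have "norm (P (F y - F x - F' x (y - x))) \<le> h (t + 0 + ?d) - h (t + 0) - h' t * ?d"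
    by (rule majorant_linearization[OF gamma_D gamma_r0(2) x(1) x(1) y_D x(2)])
       (use td t t1_le in auto)
  then have res_y: "norm (P (F y)) \<le> h (t + ?d)"
    using step_d by (simp add: Fx)
  have step_e: "- h' t * ?e \<le> h (t + ?d)"
    using e res_y by linarith
  show tde: "t + ?d + ?e < t1"
    by (rule majorant_step[OF \<gamma>_pos _ td less_t1 h_t1 neg step_e]) auto
  have x'_D: "x' \<in> D"
    by (rule in_D[OF _ tde]) (use norm_triangle_ineq[of "y - x0" "x' - y"] nd in simp)
  have "norm (P (F x' - F y - F' x (x' - y))) \<le> h (t + ?d + ?e) - h (t + ?d) - h' t * ?e"
    by (rule majorant_linearization[OF gamma_D gamma_r0(2) x(1) y_D x'_D x(2)])
       (use td tde t1_le in auto)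
  then show "norm (P (F x')) \<le> h (t + ?d + ?e)"
    using step_e by (simp add: Fy)
qed

lemma X_dist: "norm (X k - x0) \<le> path_length k"
proof (induction k)
  case (Suc k)
  have "norm (X (Suc k) - x0) \<le> norm (X k - x0) + norm (Y k - X k) + norm (X (Suc k) - Y k)"
    using norm_triangle_ineq[of "X k - x0" "Y k - X k"]
      norm_triangle_ineq[of "Y k - x0" "X (Suc k) - Y k"] by (simp del: two_step_newton.simps)
  then show ?case
    using Suc by (simp add: path_length_Suc del: two_step_newton.simps)
qed (simp add: path_length_def)

lemma invariant: "path_length k < t1 \<and> norm (P (F (X k))) \<le> h (path_length k)"
proof (induction k)
  case 0
  then show ?case
    by (simp add: path_length_def majorant_0 t1_pos)
next
  case (Suc k)
  then have X: "X k \<in> D"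
    using in_D[OF X_dist] by blast
  show ?case
    using two_step(2,3)[OF X X_dist] Suc unfolding X_Suc path_length_Suc by blast
qed

lemma X_in_D: "X k \<in> D"
  using in_D[OF X_dist] invariant by blast

lemma path_length_Y: "path_length k + norm (Y k - X k) < t1"
  using two_step(1)[OF X_in_D X_dist] invariant by blast

lemma X_in_ball: "X k \<in> ball x0 r0"
  using X_dist[of k] invariant[of k] t1_le by (simp add: dist_norm norm_minus_commute)

lemma path_length_lt_r0: "path_length k < r0"
  using invariant[of k] t1_le by simp

lemma well_defined: "two_step_newton_well_defined D F F' x0"
proof -
  have "Y k \<in> D" for k
    by (rule in_D[OF _ path_length_Y[of k]])
       (use norm_triangle_ineq[of "X k - x0" "Y k - X k"] X_dist[of k] in simp)
  then show ?thesis
    unfolding two_step_newton_well_defined_def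
    using X_in_D derivative_invertible(1)[OF X_in_D X_dist path_length_lt_r0] by blast
qed

section \<open>Passage to the limit\<close>

lemma path_length_mono: "incseq path_length"
  by (intro incseq_SucI) (simp add: path_length_Suc)

lemma path_length_convergent: "convergent path_length"
  using incseq_bounded[OF path_length_mono] invariant
  by (metis (no_types) Bseq_mono_convergent incseqD incseq_convergent less_imp_le path_length_mono
      convergent_def)

lemma X_diff: "k \<le> m \<Longrightarrow> norm (X m - X k) \<le> path_length m - path_length k"
proof (induction m rule: dec_induct)
  case (step m)
  have "norm (X (Suc m) - X k) \<le> norm (X m - X k) + norm (Y m - X m) + norm (X (Suc m) - Y m)"
    using norm_triangle_ineq[of "X m - X k" "Y m - X m"]
      norm_triangle_ineq[of "Y m - X k" "X (Suc m) - Y m"] by (simp del: two_step_newton.simps)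
  then show ?case
    using step.IH by (simp add: path_length_Suc del: two_step_newton.simps)
qed simp

lemma X_convergent: "convergent X"
proof -
  have "Cauchy X"
  proof (rule metric_CauchyI)
    fix e :: real assume "0 < e"
    have "Cauchy path_length"
      using path_length_convergent Cauchy_convergent_iff by blast
    then obtain M where M: "\<And>m n. m \<ge> M \<Longrightarrow> n \<ge> M \<Longrightarrow> dist (path_length m) (path_length n) < e"
      using \<open>0 < e\<close> unfolding Cauchy_def by meson
    have "dist (X m) (X n) < e" if "m \<ge> M" "n \<ge> M" "n \<le> m" for m n
      using X_diff[OF that(3)] M[OF that(1,2)] by (simp add: dist_norm)
    then show "\<exists>M. \<forall>m\<ge>M. \<forall>n\<ge>M. dist (X m) (X n) < e"
      by (metis dist_commute nat_le_linear)
  qed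
  then show ?thesis
    by (rule Cauchy_convergent)
qed

text \<open>Since \<open>F (X k) = F' (X k) (X k - Y k)\<close> and \<open>P F' (X k)\<close> is
  within \<open>1\<close> of the identity, the residual is at most twice the Newton correction,
  which the increments of the convergent \<open>path_length\<close> dominate.\<close>

lemma residual_tendsto: "(\<lambda>k. P (F (X k))) \<longlonglongrightarrow> 0"
proof (rule Lim_null_comparison)
  obtain L where L: "path_length \<longlonglongrightarrow> L"
    using path_length_convergent by (auto simp: convergent_def)
  show "(\<lambda>k. 2 * (path_length (Suc k) - path_length k)) \<longlonglongrightarrow> 0"
    using tendsto_mult[OF tendsto_const tendsto_diff[OF LIMSEQ_Suc[OF L] L], of 2] by simp
  show "\<forall>\<^sub>F k in sequentially. norm (P (F (X k))) \<le> 2 * (path_length (Suc k) - path_length k)"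
  proof (rule always_eventually, rule allI)
    fix k
    let ?v = "X k - Y k"
    have "F' (X k) ?v = F (X k)"
      by (simp add: newton_step_def
          blinfun_inv_right[OF derivative_invertible(1)[OF X_in_D X_dist path_length_lt_r0]])
    then have eq: "P (F (X k)) = (P o\<^sub>L (F' (X k) - F' x0)) ?v + ?v"
      by (simp add: blinfun.diff_left blinfun.diff_right[of P] blinfun_inv_left[OF inv])
    have "norm (P o\<^sub>L (F' (X k) - F' x0)) \<le> h' (0 + path_length k) - h' 0"
      by (rule derivative_diff_bound[OF gamma_D gamma_r0(2) x0 X_in_D])
         (use X_dist path_length_lt_r0 in auto)
    then have "norm (P o\<^sub>L (F' (X k) - F' x0)) \<le> 1"
      using h'_neg[OF path_length_lt_r0, of k] by (simp add: majorant_deriv_0)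
    then have "norm ((P o\<^sub>L (F' (X k) - F' x0)) ?v) \<le> norm ?v"
      using order_trans[OF norm_blinfun mult_right_mono[OF _ norm_ge_zero]] by fastforce
    then have "norm (P (F (X k))) \<le> 2 * norm ?v"
      unfolding eq using norm_triangle_ineq[of "(P o\<^sub>L (F' (X k) - F' x0)) ?v" ?v] by linarith
    also have "norm ?v \<le> path_length (Suc k) - path_length k"
      by (simp add: path_length_Suc norm_minus_commute)
    finally show "norm (P (F (X k))) \<le> 2 * (path_length (Suc k) - path_length k)"
      by simp
  qed
qed

definition xs :: 'a where "xs = lim X"

lemma X_tendsto: "X \<longlonglongrightarrow> xs"
  using X_convergent by (simp add: xs_def convergent_LIMSEQ_iff)

lemma xs_dist: "norm (xs - X k) \<le> t1 - path_length k"
proof (rule LIMSEQ_le_const2)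
  show "(\<lambda>m. norm (X m - X k)) \<longlonglongrightarrow> norm (xs - X k)"
    by (intro tendsto_intros X_tendsto)
  show "\<exists>N. \<forall>m\<ge>N. norm (X m - X k) \<le> t1 - path_length k"
  proof (intro exI[of _ k] allI impI)
    fix m assume "k \<le> m"
    show "norm (X m - X k) \<le> t1 - path_length k"
      using X_diff[OF \<open>k \<le> m\<close>] invariant[of m] by simp
  qed
qed

lemma xs_dist_x0: "norm (xs - x0) \<le> t1"
  using xs_dist[of 0] by (simp add: path_length_def)

text \<open>\<open>residual_lipschitz\<close> is applied to \<open>z\<close> and \<open>X k\<close>
  and then passed to the limit, so \<open>xs\<close> itself need not be in the open ball.\<close>

lemma residual_le:
  assumes "z \<in> ball x0 r0"
  shows "norm (P (F z)) \<le> 2 * norm (z - xs)"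
proof (rule LIMSEQ_le)
  show "(\<lambda>k. norm (P (F z) - P (F (X k)))) \<longlonglongrightarrow> norm (P (F z))"
    using tendsto_norm[OF tendsto_diff[OF tendsto_const residual_tendsto], of "P (F z)"] by simp
  show "(\<lambda>k. 2 * norm (z - X k)) \<longlonglongrightarrow> 2 * norm (z - xs)"
    by (intro tendsto_intros X_tendsto)
  show "\<exists>N. \<forall>k\<ge>N. norm (P (F z) - P (F (X k))) \<le> 2 * norm (z - X k)"
    using residual_lipschitz[OF X_in_ball assms] by blast
qed

lemma F_eq: "F z = F' x0 (P (F z))"
  by (simp add: blinfun_inv_right[OF inv])

text \<open>The substitute for \<open>F xs = 0\<close> when \<open>xs\<close> may lie outside
  \<open>D\<close>.\<close>

lemma F_tendsto: "(F \<longlongrightarrow> 0) (at xs within ball x0 r0)"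
proof -
  have "((\<lambda>z. P (F z)) \<longlongrightarrow> 0) (at xs within ball x0 r0)"
  proof (rule Lim_null_comparison)
    show "\<forall>\<^sub>F z in at xs within ball x0 r0. norm (P (F z)) \<le> 2 * norm (z - xs)"
      unfolding eventually_at_topological using residual_le by blast
    show "((\<lambda>z. 2 * norm (z - xs)) \<longlongrightarrow> 0) (at xs within ball x0 r0)"
      by (rule tendsto_eq_intros refl | simp)+
  qed
  then have "((\<lambda>z. F' x0 (P (F z))) \<longlongrightarrow> F' x0 0) (at xs within ball x0 r0)"
    by (intro tendsto_intros)
  then show ?thesis
    by (simp flip: F_eq)
qed

lemma xs_root:
  assumes "xs \<in> D"
  shows "F xs = 0"
proof (rule LIMSEQ_unique)
  show "(\<lambda>k. F (X k)) \<longlonglongrightarrow> F xs"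
    using has_derivative_continuous[OF deriv[OF assms]] X_tendsto by (rule isCont_tendsto_compose)
  have "(\<lambda>k. F' x0 (P (F (X k)))) \<longlonglongrightarrow> F' x0 0"
    by (intro tendsto_intros residual_tendsto)
  then show "(\<lambda>k. F (X k)) \<longlonglongrightarrow> 0"
    by (simp flip: F_eq)
qed

text \<open>With \<open>e = norm (z - x0)\<close>, expansion at \<open>x0\<close> gives
  \<open>e \<le> \<beta> + error\<close>, where the error is at most
  \<open>h e - \<beta> + e\<close> because \<open>h 0 = \<beta>\<close> and
  \<open>h' 0 = - 1\<close>. The radius \<open>r\<close> may exceed \<open>r0\<close>.\<close>

lemma h_nonneg_at_root:
  assumes gam: "gamma_condition F' x0 \<gamma> (D \<inter> ball x0 r) r" and r: "0 < r" "\<gamma> * r < 1"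
    and z: "z \<in> D" "norm (z - x0) \<le> r" "F z = 0"
  shows "0 \<le> h (norm (z - x0))"
proof -
  let ?e = "norm (z - x0)"
  have "norm (P (F z - F x0 - F' x0 (z - x0))) \<le> h (0 + 0 + ?e) - h (0 + 0) - h' 0 * ?e"
    by (rule majorant_linearization[OF gam r(2) x0 x0 z(1)]) (use r z in auto)
  then have "norm (- P (F x0) - (z - x0)) \<le> h ?e - norm (P (F x0)) + ?e"
    by (simp add: z(3) blinfun.diff_right blinfun.minus_right blinfun_inv_left[OF inv]
        majorant_0 majorant_deriv_0)
  moreover have "?e \<le> norm (- P (F x0) - (z - x0)) + norm (P (F x0))"
    using norm_triangle_ineq4[of "- P (F x0) - (z - x0)" "- P (F x0)"]
    by (simp add: norm_minus_commute)
  ultimately show ?thesis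
    by linarith
qed

end

section \<open>Uniqueness and cubic convergence\<close>

locale gamma_newton_simple_root = gamma_newton_root +
  assumes t1_less: "t1 < r0"
begin

lemma h'_t1: "h' t1 < 0"
  by (rule h'_neg[OF t1_less])

lemma xs_in_ball: "xs \<in> ball x0 r0"
  using xs_dist_x0 t1_less by (simp add: dist_norm norm_minus_commute)

lemma xs_in_D: "xs \<in> D"
  using xs_in_ball ball by blast

text \<open>On the ball of radius \<open>t1\<close> the factor in \<open>near_identity\<close> is
  \<open>1 + h' t1 < 1\<close>, which two distinct zeros would contradict.\<close>

lemma root_unique:
  assumes "norm (z - x0) \<le> t1" "F z = 0"
  shows "z = xs"
proof -
  have "z \<in> ball x0 r0"
    using assms t1_less by (simp add: dist_norm norm_minus_commute)
  then have "norm (P (F z - F xs) - (z - xs)) \<le> (1 + h' t1) * norm (z - xs)"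
    using near_identity[OF xs_in_ball xs_dist_x0 _ assms(1) t1_le] by blast
  then have "0 \<le> h' t1 * norm (z - xs)"
    by (simp add: assms(2) xs_root[OF xs_in_D] norm_minus_commute algebra_simps)
  then show ?thesis
    using h'_t1 by (simp add: zero_le_mult_iff)
qed

section \<open>Error estimates in powers of the distance to the limit\<close>

definition lip :: real where "lip = 2 * \<gamma> / (1 - \<gamma> * t1) ^ 3"
text \<open>Here \<open>lip\<close> is the second derivative of \<open>h\<close> at
  \<open>t1\<close>, and \<open>quad\<close> is the constant \<open>K\<close> of the
  overview.\<close>

definition quad :: real where "quad = lip / (2 * - h' t1)"

lemma lip_pos: "0 < lip"
  using \<gamma>_pos less_t1[of t1] by (simp add: lip_def)

lemma quad_pos: "0 < quad"
  unfolding quad_def using lip_pos h'_t1 by (intro divide_pos_pos) auto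

lemma derivative_lipschitz:
  assumes "p \<in> D" "norm (p - X k) \<le> b" "path_length k + b \<le> t1"
  shows "norm (P o\<^sub>L (F' p - F' (X k))) \<le> lip * b"
proof -
  have b: "0 \<le> b"
    using assms(2) norm_ge_zero order_trans by blast
  have "norm (P o\<^sub>L (F' p - F' (X k))) \<le> h' (path_length k + b) - h' (path_length k)"
    by (rule derivative_diff_bound[OF gamma_D gamma_r0(2) X_in_D assms(1) X_dist assms(2)])
       (use assms(3) t1_less in simp)
  also have "\<dots> \<le> lip * b"
    unfolding lip_def by (rule majorant_deriv_lipschitz[OF \<gamma>_pos b assms(3) less_t1]) simp
  finally show ?thesis .
qed

lemma inverse_bound: "norm (blinfun_inv (F' (X k)) w) \<le> norm (P w) / - h' t1"
proof (rule derivative_invertible(2)[OF X_in_D _ t1_less])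
  show "norm (X k - x0) \<le> t1"
    using X_dist[of k] invariant[of k] by simp
qed

lemma inverse_cancel: "blinfun_inv (F' (X k)) (F' (X k) v) = v"
  by (rule blinfun_inv_left[OF derivative_invertible(1)[OF X_in_D X_dist path_length_lt_r0]])

text \<open>As \<open>F xs = 0\<close>, the error \<open>Y k - xs\<close> is the inverse of
  \<open>F' (X k)\<close> applied to the linearization error at \<open>X k\<close>; the factor
  \<open>\<tau>\<close> in its bound integrates to the \<open>1 / 2\<close> in
  \<open>quad\<close>.\<close>

lemma newton_error: "norm (xs - Y k) \<le> quad * norm (xs - X k) ^ 2"
proof -
  let ?e = "norm (xs - X k)"
  let ?\<phi> = "\<lambda>\<tau>. lip * ?e ^ 2 * \<tau> ^ 2 / 2"
  have "norm (P (F xs - F (X k) - F' (X k) (xs - X k))) \<le> ?\<phi> 1 - ?\<phi> 0"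
  proof (rule linearization_bound[where \<phi> = ?\<phi>])
    fix p assume "p \<in> closed_segment (X k) xs"
    then show "(F has_derivative blinfun_apply (F' p)) (at p)"
      using convex_D X_in_D xs_in_D deriv by (meson closed_segment_subset subsetD)
  next
    fix \<tau> :: real assume \<tau>: "0 < \<tau>" "\<tau> < 1"
    let ?p = "X k + \<tau> *\<^sub>R (xs - X k)"
    have "?p \<in> D"
      using convexD_alt[OF convex_D X_in_D xs_in_D, of \<tau> k] \<tau> by (simp add: algebra_simps)
    moreover have "\<tau> * ?e \<le> ?e"
      using \<tau> by (simp add: mult_left_le_one_le)
    then have "path_length k + \<tau> * ?e \<le> t1"
      using xs_dist[of k] by simp
    ultimately have "norm (P o\<^sub>L (F' ?p - F' (X k))) \<le> lip * (\<tau> * ?e)"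
      using \<tau> by (intro derivative_lipschitz) simp_all
    then have "norm (P o\<^sub>L (F' ?p - F' (X k))) * ?e \<le> lip * (\<tau> * ?e) * ?e"
      by (rule mult_right_mono) simp
    then show "norm (P o\<^sub>L (F' ?p - F' (X k))) * ?e \<le> lip * ?e ^ 2 * \<tau>"
      by (simp add: power2_eq_square algebra_simps)
  qed (auto intro!: continuous_intros derivative_eq_intros)
  then have le: "norm (P (F xs - F (X k) - F' (X k) (xs - X k))) \<le> lip * ?e ^ 2 / 2"
    by simp
  have "Y k - xs = blinfun_inv (F' (X k)) (F xs - F (X k) - F' (X k) (xs - X k))"
    by (simp add: newton_step_def xs_root[OF xs_in_D] blinfun.diff_right blinfun.minus_right
        inverse_cancel)
  then have "norm (xs - Y k) \<le> norm (P (F xs - F (X k) - F' (X k) (xs - X k))) / - h' t1"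
    using inverse_bound by (metis norm_minus_commute)
  also have "\<dots> \<le> (lip * ?e ^ 2 / 2) / - h' t1"
    using h'_t1 by (intro divide_right_mono le) simp
  finally show ?thesis
    by (simp add: quad_def)
qed

text \<open>One power of the error comes from \<open>b\<close>, the variation of the derivative
  around \<open>X k\<close>, and two come from \<open>newton_error\<close>.\<close>

lemma two_step_error:
  "norm (xs - X (Suc k)) \<le> 2 * quad ^ 2 * (1 + quad * norm (xs - X k)) * norm (xs - X k) ^ 3"
proof -
  let ?e = "norm (xs - X k)"
  \<comment> \<open>The ball of radius \<open>b\<close> around \<open>X k\<close> contains the
    segment from \<open>Y k\<close> to \<open>xs\<close>. Each of the two distances, added to
    \<open>path_length k\<close>, stays within \<open>t1\<close>, hence so does their
    maximum.\<close>
  define b where "b = max ?e (norm (Y k - X k))"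
  let ?\<phi> = "\<lambda>\<tau>. \<tau> * (lip * b * norm (xs - Y k))"
  have b: "path_length k + b \<le> t1"
    using xs_dist[of k] path_length_Y[of k] by (simp add: b_def)
  have Y_D: "Y k \<in> D"
    using well_defined by (simp add: two_step_newton_well_defined_def)
  have "norm (P (F xs - F (Y k) - F' (X k) (xs - Y k))) \<le> ?\<phi> 1 - ?\<phi> 0"
  proof (rule linearization_bound[where \<phi> = ?\<phi>])
    fix p assume "p \<in> closed_segment (Y k) xs"
    then show "(F has_derivative blinfun_apply (F' p)) (at p)"
      using convex_D Y_D xs_in_D deriv by (meson closed_segment_subset subsetD)
  next
    fix \<tau> :: real assume \<tau>: "0 < \<tau>" "\<tau> < 1"
    let ?p = "Y k + \<tau> *\<^sub>R (xs - Y k)"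
    have "?p \<in> D"
      using convexD_alt[OF convex_D Y_D xs_in_D, of \<tau>] \<tau> by (simp add: algebra_simps)
    moreover have "?p \<in> cball (X k) b"
      using convexD_alt[OF convex_cball, of "Y k" "X k" b xs \<tau>] \<tau>
      by (simp add: b_def dist_norm norm_minus_commute algebra_simps)
    then have "norm (?p - X k) \<le> b"
      by (simp add: dist_norm norm_minus_commute)
    ultimately have "norm (P o\<^sub>L (F' ?p - F' (X k))) \<le> lip * b"
      using b by (intro derivative_lipschitz)
    then show "norm (P o\<^sub>L (F' ?p - F' (X k))) * norm (xs - Y k) \<le> lip * b * norm (xs - Y k)"
      by (rule mult_right_mono) simp
  qed (auto intro!: continuous_intros derivative_eq_intros)
  then have le: "norm (P (F xs - F (Y k) - F' (X k) (xs - Y k))) \<le> lip * b * norm (xs - Y k)"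
    by simp
  have "X (Suc k) - xs = blinfun_inv (F' (X k)) (F xs - F (Y k) - F' (X k) (xs - Y k))"
    unfolding X_Suc by (simp add: xs_root[OF xs_in_D] blinfun.diff_right[of "blinfun_inv (F' (X k))"]
        blinfun.minus_right inverse_cancel)
  then have "norm (xs - X (Suc k)) \<le> norm (P (F xs - F (Y k) - F' (X k) (xs - Y k))) / - h' t1"
    using inverse_bound by (metis norm_minus_commute)
  also have "\<dots> \<le> (lip * b * norm (xs - Y k)) / - h' t1"
    using h'_t1 by (intro divide_right_mono le) simp
  also have "\<dots> = 2 * quad * b * norm (xs - Y k)"
    by (simp add: quad_def)
  also have "\<dots> \<le> 2 * quad * (?e + quad * ?e ^ 2) * (quad * ?e ^ 2)"
  proof (intro mult_mono newton_error)
    have "norm (Y k - X k) \<le> ?e + norm (xs - Y k)"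
      using norm_triangle_ineq4[of "xs - X k" "xs - Y k"] by simp
    then show "b \<le> ?e + quad * ?e ^ 2"
      using newton_error[of k] quad_pos by (simp add: b_def)
  qed (use quad_pos in \<open>auto simp: b_def le_max_iff_disj intro!: mult_nonneg_nonneg\<close>)
  also have "\<dots> = 2 * quad ^ 2 * (1 + quad * ?e) * ?e ^ 3"
    by (simp add: power2_eq_square power3_eq_cube algebra_simps)
  finally show ?thesis .
qed

lemma cubic_bound: "norm (xs - X (Suc k)) \<le> 2 * quad ^ 2 * (1 + quad * t1) * norm (xs - X k) ^ 3"
proof (rule order_trans[OF two_step_error])
  have "0 \<le> path_length k"
    using order_trans[OF norm_ge_zero X_dist] .
  then have "norm (xs - X k) \<le> t1"
    using xs_dist[of k] by simp
  then show "2 * quad ^ 2 * (1 + quad * norm (xs - X k)) * norm (xs - X k) ^ 3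
    \<le> 2 * quad ^ 2 * (1 + quad * t1) * norm (xs - X k) ^ 3"
    using quad_pos by (intro mult_right_mono mult_left_mono add_left_mono) auto
qed

lemma converges_cubically: "Q_cubic X xs"
  unfolding Q_cubic_def
proof (intro conjI X_tendsto exI[of _ "2 * quad ^ 2 * (1 + quad * t1)"] exI[of _ 0] allI impI)
  show "0 \<le> 2 * quad\<^sup>2 * (1 + quad * t1)"
    using quad_pos t1_pos by simp
  show "norm (X (Suc k) - xs) \<le> 2 * quad\<^sup>2 * (1 + quad * t1) * norm (X k - xs) ^ 3" for k
    using cubic_bound[of k] by (simp only: norm_minus_commute)
qed

end

text \<open>The cubic constant times the surplus factor \<open>norm (x k - l)\<close> eventually
  drops below any \<open>c\<close>.\<close>

lemma Q_cubic_imp_Q_superquadratic: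
  assumes "Q_cubic x l"
  shows "Q_superquadratic x l"
  unfolding Q_superquadratic_def
proof (intro conjI allI impI)
  show lim: "x \<longlonglongrightarrow> l"
    using assms by (simp add: Q_cubic_def)
  obtain C N where C: "0 \<le> C" and N: "\<And>k. k \<ge> N \<Longrightarrow> norm (x (Suc k) - l) \<le> C * norm (x k - l) ^ 3"
    using assms by (auto simp: Q_cubic_def)
  fix c :: real assume "0 < c"
  have "(\<lambda>k. C * norm (x k - l)) \<longlonglongrightarrow> C * norm (l - l)"
    by (intro tendsto_intros lim)
  then have "\<forall>\<^sub>F k in sequentially. C * norm (x k - l) < c"
    using \<open>0 < c\<close> by (intro order_tendstoD(2)) auto
  then obtain M where M: "\<And>k. k \<ge> M \<Longrightarrow> C * norm (x k - l) < c"
    by (auto simp: eventually_sequentially)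
  have "norm (x (Suc k) - l) \<le> c * norm (x k - l) ^ 2" if "k \<ge> max M N" for k
  proof -
    have "norm (x (Suc k) - l) \<le> (C * norm (x k - l)) * norm (x k - l) ^ 2"
      using N[of k] that by (simp add: eval_nat_numeral mult.assoc)
    also have "\<dots> \<le> c * norm (x k - l) ^ 2"
      using M[of k] that by (intro mult_right_mono) auto
    finally show ?thesis .
  qed
  then show "\<exists>N. \<forall>k\<ge>N. norm (x (Suc k) - l) \<le> c * norm (x k - l) ^ 2"
    by blast
qed

section \<open>The roots of the majorant function\<close>

lemma majorant_quadratic:
  assumes "\<gamma> > 0" "\<gamma> * t < 1"
  shows "majorant \<gamma> \<beta> t = (\<beta> - (1 + \<beta> * \<gamma>) * t + 2 * \<gamma> * t ^ 2) / (1 - \<gamma> * t)"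
  using assms unfolding majorant_def by (simp add: divide_simps) algebra

context
  fixes \<alpha> s :: real
  assumes \<alpha>: "0 < \<alpha>" "\<alpha> \<le> 3 - 2 * sqrt 2" and s: "s = sqrt ((1 + \<alpha>) ^ 2 - 8 * \<alpha>)"
begin

lemma discriminant: "s ^ 2 = (1 + \<alpha>) ^ 2 - 8 * \<alpha>" "0 \<le> s"
proof -
  have "(2 * sqrt 2) ^ 2 \<le> (3 - \<alpha>) ^ 2"
    using \<alpha> by (intro power_mono) auto
  then have "0 \<le> (1 + \<alpha>) ^ 2 - 8 * \<alpha>"
    by (simp add: power2_eq_square algebra_simps)
  then show "s ^ 2 = (1 + \<alpha>) ^ 2 - 8 * \<alpha>" "0 \<le> s"
    by (simp_all add: s)
qed

lemma discriminant_le: "s \<le> 1 - \<alpha>"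
proof (rule power2_le_imp_le)
  show "s ^ 2 \<le> (1 - \<alpha>) ^ 2"
    unfolding discriminant(1) using \<alpha>(1) by (simp add: power2_eq_square algebra_simps)
  have "1 \<le> sqrt 2"
    by simp
  then show "0 \<le> 1 - \<alpha>"
    using \<alpha>(2) by linarith
qed

lemma discriminant_pos:
  assumes "\<alpha> < 3 - 2 * sqrt 2"
  shows "0 < s"
proof -
  have "(2 * sqrt 2) ^ 2 < (3 - \<alpha>) ^ 2"
    using assms by (intro power_strict_mono) auto
  then show ?thesis
    unfolding s by (simp add: power2_eq_square algebra_simps)
qed

text \<open>The two fractions are \<open>1 - \<gamma> r0\<close> and \<open>1 - \<gamma> t1\<close>:
  the gap \<open>\<gamma> (r0 - t1)\<close> is at least \<open>s / 4\<close>, so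
  \<open>s > 0\<close> keeps \<open>t1\<close> away from \<open>r0\<close>.\<close>

lemma one_minus_root_ge: "1 / sqrt 2 + s / 4 \<le> (3 - \<alpha> + s) / 4"
proof -
  have "1 / sqrt 2 = sqrt 2 / 2"
    by (simp add: field_simps)
  then show ?thesis
    using \<alpha>(2) by simp
qed

lemma one_minus_root_pos: "0 < (3 - \<alpha> + s) / 4"
proof -
  have "0 < 1 / sqrt 2"
    by simp
  then show ?thesis
    using one_minus_root_ge discriminant(2) by linarith
qed

text \<open>The quadratic equation of \<open>t1\<close> in the variable
  \<open>w = 1 - \<gamma> t1\<close>, with \<open>\<alpha>\<close> eliminated through
  \<open>3 - \<alpha> = 4 w - s\<close>. It yields
  \<open>h' t1 = 1 / w^2 - 2 = - s / w\<close>.\<close>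

lemma root_identity: "2 * ((3 - \<alpha> + s) / 4) ^ 2 = s * ((3 - \<alpha> + s) / 4) + 1"
  using discriminant(1) by (simp add: power2_eq_square field_simps)

text \<open>In terms of \<open>w = 1 - \<gamma> t1\<close> one has
  \<open>\<alpha> = 3 - 2 w - 1 / w\<close>, and the second claim, which is \<open>K t1 < 1\<close>,
  reduces to \<open>2 w^3 > 1\<close>. The threshold for \<open>\<alpha>\<close> is the value at
  \<open>w = 1 / a\<close> with \<open>a = root 3 2\<close>, as \<open>2 / a = a^2\<close>.\<close>

lemma cubic_threshold:
  assumes "\<alpha> < 3 - root 3 2 - root 3 4"
  shows "\<alpha> < 3 - 2 * sqrt 2" and "4 * (1 + \<alpha> - s) < s * (3 - \<alpha> + s) ^ 2"
proof -
  define a where "a = root 3 2"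
  define w where "w = (3 - \<alpha> + s) / 4"
  have a: "0 < a" "a ^ 3 = 2"
    by (simp_all add: a_def)
  have "root 3 4 = root 3 2 * root 3 2"
    by (simp flip: real_root_mult)
  then have \<alpha>_less: "\<alpha> < 3 - a - a ^ 2"
    using assms by (simp add: a_def power2_eq_square)
  \<comment> \<open>Arithmetic-geometric mean for \<open>a\<close> and \<open>a^2\<close>, whose
    product is \<open>2\<close>.\<close>
  have "8 \<le> (a + a ^ 2) ^ 2"
  proof -
    have "0 \<le> (a - a ^ 2) ^ 2"
      by simp
    also have "\<dots> = (a + a ^ 2) ^ 2 - 4 * a ^ 3"
      by (simp add: power2_eq_square power3_eq_cube algebra_simps)
    finally show ?thesis
      using a(2) by simp
  qed
  then have "(2 * sqrt 2) ^ 2 \<le> (a + a ^ 2) ^ 2"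
    by simp
  then have "2 * sqrt 2 \<le> a + a ^ 2"
    by (rule power2_le_imp_le) (use a in simp)
  then show "\<alpha> < 3 - 2 * sqrt 2"
    using \<alpha>_less by linarith
  have w: "0 < w" "2 * w ^ 2 = s * w + 1"
    using root_identity one_minus_root_pos by (simp_all add: w_def)
  have s_eq: "s = 2 * w - 1 / w" and \<alpha>_eq: "\<alpha> = 3 - 2 * w - 1 / w"
  proof -
    show "s = 2 * w - 1 / w"
      using w by (simp add: field_simps power2_eq_square)
    then show "\<alpha> = 3 - 2 * w - 1 / w"
      by (simp add: w_def field_simps)
  qed
  have "1 < 2 * w ^ 3"
  proof (rule ccontr)
    assume "\<not> 1 < 2 * w ^ 3"
    then have "(a * w) ^ 3 \<le> 1 ^ 3"
      by (simp add: power_mult_distrib a(2))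
    then have aw: "a * w \<le> 1"
      using power_mono_iff[of "a * w" 1 3] a(1) w(1) by simp
    have "1 \<le> 2 * w ^ 2"
      using w discriminant(2) by simp
    \<comment> \<open>This leads to \<open>a^2 \<le> 2 \<le> (2 w)^2\<close>, so \<open>w\<close>
      lies between \<open>a / 2\<close> and \<open>1 / a\<close>.\<close>
    have "a ^ 2 * 1 \<le> a ^ 2 * a"
      by (intro mult_left_mono) (simp_all add: a_def)
    then have "a ^ 2 \<le> (2 * w) ^ 2"
      using a(2) w(2) mult_nonneg_nonneg[OF discriminant(2) less_imp_le[OF w(1)]]
      by (simp add: power_mult_distrib eval_nat_numeral)
    then have "a \<le> 2 * w"
      by (rule power2_le_imp_le) (use w in simp)
    then have "0 \<le> (1 - a * w) * (2 * w - a)"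
      using aw by (intro mult_nonneg_nonneg) auto
    \<comment> \<open>\<open>1 / a\<close> and \<open>a / 2\<close> are the roots of \<open>2 w\<^sup>2 - (a + a\<^sup>2) w + 1\<close>, because \<open>a\<^sup>3 = 2\<close>.\<close>
    also have "\<dots> = a ^ 3 * w + a ^ 2 * w - a * (2 * w ^ 2 + 1)"
      by (simp add: a(2)) (simp add: power2_eq_square algebra_simps)
    also have "\<dots> = a * ((a + a ^ 2) * w - (2 * w ^ 2 + 1))"
      by (simp add: power2_eq_square power3_eq_cube algebra_simps)
    finally have "2 * w ^ 2 + 1 \<le> (a + a ^ 2) * w"
      using a(1) by (simp add: zero_le_mult_iff)
    then have "3 - a - a ^ 2 \<le> \<alpha>"
      unfolding \<alpha>_eq using w(1) by (simp add: field_simps power2_eq_square)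
    then show False
      using \<alpha>_less by simp
  qed
  then have "1 - w < 2 * w ^ 3 - w"
    by simp
  also have "\<dots> = s * w ^ 2"
    using w(2) by (simp add: power2_eq_square power3_eq_cube algebra_simps)
  finally show "4 * (1 + \<alpha> - s) < s * (3 - \<alpha> + s) ^ 2"
    by (simp add: w_def power2_eq_square field_simps)
qed

end

theorem corollary3p2:
  fixes F :: "'a::banach \<Rightarrow> 'b::banach"
    and F' :: "'a \<Rightarrow> ('a \<Rightarrow>\<^sub>L 'b)"
    and D :: "'a set" and x0 :: 'a and \<gamma> r0 \<alpha> s t1 t2 H q :: real
    and x :: "nat \<Rightarrow> 'a"
  assumes "r0 = (1 - 1 / sqrt 2) * (1 / \<gamma>)"
    and "\<alpha> = norm (blinfun_inv (F' x0) (F x0)) * \<gamma>"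
    and "s = sqrt ((1 + \<alpha>) ^ 2 - 8 * \<alpha>)"
    and "t1 = (1 + \<alpha> - s) / (4 * \<gamma>)"
    and "t2 = (1 + \<alpha> + s) / (4 * \<gamma>)"
    and "H = - (32 * \<gamma>) / (s * (3 - \<alpha> + s) ^ 2)"
    and "q = (s * (3 - \<alpha> + s) ^ 2 + 4 * (1 + \<alpha> - s)) / (s * (3 - \<alpha> + s) ^ 2 - 4 * (1 + \<alpha> - s))"
    and "x = two_step_newton F F' x0"
    and "open D" and "convex D"
    and "\<And>z. z \<in> D \<Longrightarrow> (F has_derivative blinfun_apply (F' z)) (at z)"
    and "continuous_on D F'"
    and "\<gamma> > 0" and "x0 \<in> D" and "ball x0 r0 \<subseteq> D"
    and "blinfun_invertible (F' x0)"
    and "gamma_condition F' x0 \<gamma> (ball x0 r0) r0"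
    and "0 < \<alpha>" and "\<alpha> \<le> 3 - 2 * sqrt 2"
  shows "two_step_newton_well_defined D F F' x0 \<and>
    (\<exists>xs \<in> closure (ball x0 t1).
       x \<longlonglongrightarrow> xs \<and>
       (\<alpha> < 3 - 2 * sqrt 2 \<longrightarrow> xs \<in> D \<and> F xs = 0 \<and> Q_superquadratic x xs) \<and>
       (\<alpha> = 3 - 2 * sqrt 2 \<longrightarrow> (xs \<in> D \<longrightarrow> F xs = 0) \<and> (F \<longlongrightarrow> 0) (at xs within ball x0 r0)) \<and>
       (\<forall>r. t1 \<le> r \<and> r < t2 \<and> gamma_condition F' x0 \<gamma> (D \<inter> ball x0 r) r \<longrightarrow>
          (\<forall>z \<in> D \<inter> closure (ball x0 r). F z = 0 \<longrightarrow> z = xs)) \<and>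
       (\<alpha> < 3 - root 3 2 - root 3 4 \<longrightarrow>
          Q_cubic x xs \<and>
          (\<forall>k. norm (xs - x (Suc k)) \<le> q * H ^ 2 / 2 * norm (xs - x k) ^ 3)))"
proof -
  note \<gamma>_pos = \<open>\<gamma> > 0\<close>
  note \<alpha> = \<open>0 < \<alpha>\<close> \<open>\<alpha> \<le> 3 - 2 * sqrt 2\<close> assms(3)
  note s2 = discriminant(1)[OF \<alpha>] and s_nonneg = discriminant(2)[OF \<alpha>]
  interpret gamma_newton F F' D x0 \<gamma> r0
    by unfold_locales (fact assms)+
  define w where "w = (3 - \<alpha> + s) / 4"
  have u1: "\<gamma> * t1 = (1 + \<alpha> - s) / 4" and u2: "\<gamma> * t2 = (1 + \<alpha> + s) / 4"
    and w: "1 - \<gamma> * t1 = w"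
    using \<gamma>_pos by (simp_all add: assms(4,5) w_def field_simps)
  have w_pos: "0 < w"
    using one_minus_root_pos[OF \<alpha>] by (simp add: w_def)
  have h_eq: "h t = 2 * \<gamma> * ((t1 - t) * (t2 - t)) / (1 - \<gamma> * t)" if "\<gamma> * t < 1" for t
  proof -
    have prod: "2 * \<gamma> * (t1 * t2) = norm (P (F x0))"
    proof -
      have "\<gamma> * (2 * \<gamma> * (t1 * t2)) = 2 * ((\<gamma> * t1) * (\<gamma> * t2))"
        by simp
      also have "\<dots> = \<alpha>"
        unfolding u1 u2 using s2 by (simp add: power2_eq_square field_simps)
      finally show ?thesis
        using assms(2) \<gamma>_pos by (simp add: mult.commute)
    qed
    have sum: "1 + \<alpha> = 2 * (\<gamma> * t1 + \<gamma> * t2)"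
      unfolding u1 u2 by (simp add: field_simps)
    have "2 * \<gamma> * ((t1 - t) * (t2 - t)) = norm (P (F x0)) - (1 + \<alpha>) * t + 2 * \<gamma> * t ^ 2"
      unfolding prod[symmetric] sum by (simp add: power2_eq_square algebra_simps)
    then show ?thesis
      unfolding majorant_quadratic[OF \<gamma>_pos that] by (simp add: assms(2))
  qed
  have t1_pos: "0 < t1"
    using discriminant_le[OF \<alpha>] \<alpha>(1) \<gamma>_pos by (simp add: assms(4))
  have t1_le: "t1 \<le> r0"
  proof -
    have "\<gamma> * t1 \<le> \<gamma> * r0"
      using w one_minus_root_ge[OF \<alpha>] s_nonneg unfolding gamma_r0(1) w_def by linarith
    then show ?thesis
      using \<gamma>_pos by simp
  qed
  interpret gamma_newton_root F F' D x0 \<gamma> r0 t1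
    using t1_pos t1_le h_eq[of t1] less_r0 by unfold_locales auto
  have simple: "gamma_newton_simple_root F F' D x0 \<gamma> r0 t1" if "0 < s"
  proof unfold_locales
    have "\<gamma> * t1 < \<gamma> * r0"
      using w one_minus_root_ge[OF \<alpha>] that unfolding gamma_r0(1) w_def by linarith
    then show "t1 < r0"
      using \<gamma>_pos by simp
  qed
  have "xs \<in> closure (ball x0 t1)"
    using t1_pos xs_dist_x0 by (simp add: closure_ball dist_norm norm_minus_commute)
  moreover have "x \<longlonglongrightarrow> xs"
    using X_tendsto by (simp add: assms(8))
  moreover have "xs \<in> D \<and> F xs = 0 \<and> Q_superquadratic x xs" if "\<alpha> < 3 - 2 * sqrt 2"
  proof -
    interpret gamma_newton_simple_root F F' D x0 \<gamma> r0 t1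
      by (rule simple) (rule discriminant_pos[OF \<alpha> that])
    show ?thesis
      using xs_in_D xs_root[OF xs_in_D] Q_cubic_imp_Q_superquadratic[OF converges_cubically]
      by (simp add: assms(8))
  qed
  moreover have "z = xs"
    if r: "t1 \<le> r" "r < t2" and gam: "gamma_condition F' x0 \<gamma> (D \<inter> ball x0 r) r"
      and z: "z \<in> D" "z \<in> closure (ball x0 r)" "F z = 0" for r z
  proof -
    \<comment> \<open>For \<open>s = 0\<close> the roots coincide and no \<open>r\<close> is
      admissible.\<close>
    have "0 < s"
      using order.strict_trans1[OF r] \<gamma>_pos by (simp add: assms(4,5) divide_less_cancel)
    then interpret gamma_newton_simple_root F F' D x0 \<gamma> r0 t1
      by (rule simple)
    have "\<gamma> * r < \<gamma> * t2"
      using r(2) \<gamma>_pos by simp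
    \<comment> \<open>Since \<open>s \<le> 1 - \<alpha>\<close>, even
      \<open>\<gamma> * t2 \<le> 1 / 2\<close>.\<close>
    then have r1: "\<gamma> * r < 1"
      using discriminant_le[OF \<alpha>] unfolding u2 by simp
    have zr: "norm (z - x0) \<le> r"
      using z(2) r(1) t1_pos by (simp add: closure_ball dist_norm norm_minus_commute)
    have "0 \<le> h (norm (z - x0))"
      by (rule h_nonneg_at_root[OF gam _ r1 z(1) zr z(3)]) (use r(1) t1_pos in simp)
    moreover have "\<gamma> * norm (z - x0) \<le> \<gamma> * r"
      using zr \<gamma>_pos by simp
    then have z1: "\<gamma> * norm (z - x0) < 1"
      using r1 by simp
    ultimately have "0 \<le> (t1 - norm (z - x0)) * (t2 - norm (z - x0))"
      using \<gamma>_pos by (simp add: h_eq zero_le_divide_iff zero_le_mult_iff)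
    \<comment> \<open>The factor with \<open>t2\<close> is positive because
      \<open>norm (z - x0) \<le> r < t2\<close>.\<close>
    then have "norm (z - x0) \<le> t1"
      using zr r(2) by (simp add: zero_le_mult_iff)
    then show "z = xs"
      by (rule root_unique) (rule z(3))
  qed
  moreover have "Q_cubic x xs \<and>
    (\<forall>k. norm (xs - x (Suc k)) \<le> q * H ^ 2 / 2 * norm (xs - x k) ^ 3)"
    if small: "\<alpha> < 3 - root 3 2 - root 3 4"
  proof -
    have s_pos: "0 < s"
      by (rule discriminant_pos[OF \<alpha> cubic_threshold(1)[OF \<alpha> small]])
    interpret gamma_newton_simple_root F F' D x0 \<gamma> r0 t1
      by (rule simple[OF s_pos])
    have "2 * w ^ 2 = s * w + 1"
      unfolding w_def by (rule root_identity[OF \<alpha>])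
    then have "- (s * w) / w ^ 2 = (1 - 2 * w ^ 2) / w ^ 2"
      by simp
    then have "1 / w ^ 2 - 2 = - (s * w) / w ^ 2"
      using w_pos by (simp add: diff_divide_distrib)
    then have "h' t1 = - s / w"
      unfolding majorant_deriv_def w using w_pos by (simp add: power2_eq_square)
    then have quad_eq: "quad = \<gamma> / (s * w ^ 2)"
      unfolding quad_def lip_def w using w_pos s_pos
      by (simp add: field_simps power2_eq_square power3_eq_cube)
    have w_sq: "s * (3 - \<alpha> + s) ^ 2 = 16 * (s * w ^ 2)"
      by (simp add: w_def power2_eq_square)
    have H_eq: "H = - 2 * quad"
      unfolding assms(6) quad_eq w_sq by simp
    have "4 * (1 + \<alpha> - s) = 16 * (s * w ^ 2) * (quad * t1)"
      using u1 w_pos s_pos by (simp add: quad_eq)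
    then have q_eq: "q = (1 + quad * t1) / (1 - quad * t1)" and "quad * t1 < 1"
      using cubic_threshold(2)[OF \<alpha> small] w_pos s_pos unfolding assms(7) w_sq
      by (simp_all add: divide_simps) (simp_all add: algebra_simps)
    \<comment> \<open>For \<open>0 < u < 1\<close> one has
      \<open>1 + u \<le> (1 + u) / (1 - u)\<close>, so the constant of \<open>cubic_bound\<close> is
      at most the asserted one.\<close>
    then have "1 + quad * t1 \<le> q"
      using quad_pos t1_pos by (simp add: pos_le_divide_eq mult_left_le)
    then have "2 * quad ^ 2 * (1 + quad * t1) \<le> 2 * quad ^ 2 * q"
      by (intro mult_left_mono) auto
    also have "\<dots> = q * H ^ 2 / 2"
      by (simp add: H_eq power2_eq_square)
    finally have "norm (xs - X (Suc k)) \<le> q * H ^ 2 / 2 * norm (xs - X k) ^ 3" for k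
      using cubic_bound[of k] by (meson mult_right_mono norm_ge_zero order_trans zero_le_power)
    then show ?thesis
      using converges_cubically unfolding assms(8) by blast
  qed
  ultimately show ?thesis
    using well_defined xs_root F_tendsto by blast
qed

end
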